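(* Let $P=\{x\in\mathbb{R}^n_+\mid Ax\ge b,\ x\le u\}$ be a covering polyhedron with bounds. Then for any subset $\{e_j\}_{j\in J}$, $J\subseteq[n]$, of the canonical basis vectors, $P+\operatorname{cone}(\{e_j\}_{j\in J})$ is a covering polyhedron with bounds. In particular, $P+\mathbb{R}^n_+$ is a covering polyhedron. Moreover, $P+\operatorname{cone}(\{e_j\}_{j\in J})$ has a description as a covering polyhedron with bounds in which each covering inequality is a conic combination of one covering inequality of $P$ (i.e. one row of $Ax\ge b$) with the bounds $x_j\le u_j$ for $j\in J$.
   Context: A covering polyhedron with bounds is a set $\{x\in\mathbb{R}^n_+\mid Ax\ge b,\ x\le u\}$ with $A,b$ rational and entrywise non-negative and each component of $u$ either a non-negative integer or $+\infty$ (an infinite bound imposes no constraint and is not used in conic combinations). If all $u_j=+\infty$ it is called a covering polyhedron. The inequalities $Ax\ge b$ are called the covering inequalities. $\operatorname{cone}(S)$ is the conic hull of $S$; $+$ denotes Minkowski sum. *)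

theory Defs
  imports "HOL-Analysis.Analysis"
begin

text \<open>
  A system \<open>A x \<ge> b\<close> with \<open>m\<close> rows is given by the rows \<open>A i\<close> and right-hand sides \<open>b i\<close>
  for \<open>i < m\<close>; values at indices \<open>i \<ge> m\<close> are irrelevant.  The number of rows is a natural
  number rather than a type, since different descriptions of one polyhedron may have
  different numbers of rows; \<open>m = 0\<close> is allowed.
\<close>

definition covering_system :: "nat \<Rightarrow> (nat \<Rightarrow> real ^ 'n::finite) \<Rightarrow> (nat \<Rightarrow> real) \<Rightarrow> bool" where
  "covering_system m A b \<longleftrightarrow>
     (\<forall>i<m. (\<forall>j. A i $ j \<in> \<rat> \<and> 0 \<le> A i $ j) \<and> b i \<in> \<rat> \<and> 0 \<le> b i)"

text \<open>The type \<^typ>\<open>enat\<close> is exactly the non-negative integers together with \<open>\<infinity>\<close>.\<close>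

definition bounded_polyhedron ::
    "nat \<Rightarrow> (nat \<Rightarrow> real ^ 'n::finite) \<Rightarrow> (nat \<Rightarrow> real) \<Rightarrow> ('n \<Rightarrow> enat) \<Rightarrow> (real ^ 'n) set" where
  "bounded_polyhedron m A b u =
     {x. (\<forall>j. 0 \<le> x $ j) \<and> (\<forall>i<m. A i \<bullet> x \<ge> b i) \<and>
         (\<forall>j. ereal (x $ j) \<le> ereal_of_enat (u j))}"

definition covering_polyhedron_with_bounds :: "(real ^ 'n::finite) set \<Rightarrow> bool" where
  "covering_polyhedron_with_bounds P \<longleftrightarrow>
     (\<exists>m A b u. covering_system m A b \<and> P = bounded_polyhedron m A b u)"

definition covering_polyhedron :: "(real ^ 'n::finite) set \<Rightarrow> bool" where
  "covering_polyhedron P \<longleftrightarrow>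
     (\<exists>m A b. covering_system m A b \<and> P = bounded_polyhedron m A b (\<lambda>_. \<infinity>))"

text \<open>
  Conic hulls are \<open>convex_cone hull\<close>, the set of all non-negative linear combinations; in
  particular the hull of the empty set is \<open>{0}\<close>.  (The library's \<open>conic hull\<close> only closes
  under non-negative scaling.)
\<close>

definition coordinate_cone :: "'n::finite set \<Rightarrow> (real ^ 'n) set" where
  "coordinate_cone J = convex_cone hull ((\<lambda>j. axis j 1) ` J)"

text \<open>
  The pair \<open>(a, \<beta>)\<close> stands for the inequality \<open>a \<bullet> x \<ge> \<beta>\<close>, so that \<open>x $ j \<le> u j\<close> becomes
  \<open>(- axis j 1, - u j)\<close>.  Infinite bounds contribute no inequality.
\<close>

definition bound_inequalities :: "('n::finite \<Rightarrow> enat) \<Rightarrow> 'n set \<Rightarrow> ((real ^ 'n) \<times> real) set" where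
  "bound_inequalities u J = {(- axis j 1, - real (the_enat (u j))) |j. j \<in> J \<and> u j \<noteq> \<infinity>}"

definition conic_combination :: "((real ^ 'n::finite) \<times> real) set \<Rightarrow> (real ^ 'n) \<times> real \<Rightarrow> bool" where
  "conic_combination S c \<longleftrightarrow> c \<in> convex_cone hull S"

end

theory Submission
  imports Defs
begin

text \<open>
  A point \<open>x\<close> lies in \<open>P + cone {e\<^sub>j | j \<in> J}\<close> iff truncating its \<open>J\<close>-coordinates at the bounds
  gives a point of \<open>P\<close>.  The truncation satisfies \<open>a \<bullet> y \<ge> \<beta>\<close> iff \<open>x\<close> satisfies the inequalities
  obtained by cancelling, for each set \<open>S \<subseteq> J\<close> of finitely bounded coordinates, the coefficients
  \<open>a\<^sub>j\<close>, \<open>j \<in> S\<close>, with the bounds; the relevant \<open>S\<close> is the set of truncated coordinates.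
  Those with negative right-hand side hold for all non-negative \<open>x\<close> and are dropped.
\<close>

lemma ereal_le_ereal_of_enat_iff:
  "ereal x \<le> ereal_of_enat k \<longleftrightarrow> k = \<infinity> \<or> x \<le> real (the_enat k)"
  by (cases k) auto

lemma sum_in_convex_cone_hull:
  assumes "\<And>i. i \<in> I \<Longrightarrow> f i \<in> convex_cone hull S"
  shows "sum f I \<in> convex_cone hull S"
  using assms
  by (induction I rule: infinite_finite_induct)
    (auto simp: convex_cone_hull_contains_0 intro: convex_cone_hull_add)

text \<open>The right-hand side is itself a convex cone containing the generators, and each of its
  points is their combination with its own coordinates as coefficients.\<close>

lemma coordinate_cone_eq:
  "coordinate_cone J = {x. (\<forall>j. 0 \<le> x $ j) \<and> (\<forall>j. j \<notin> J \<longrightarrow> x $ j = 0)}"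
  (is "_ = ?C")
proof
  show "coordinate_cone J \<subseteq> ?C"
    unfolding coordinate_cone_def
    by (rule hull_minimal) (auto simp: convex_cone_iff axis_def)
next
  show "?C \<subseteq> coordinate_cone J"
  proof
    fix x assume x: "x \<in> ?C"
    have "x = (\<Sum>j\<in>J. x $ j *\<^sub>R axis j 1)"
      using x by (auto simp: vec_eq_iff axis_def if_distrib cong: if_cong)
    also have "\<dots> \<in> coordinate_cone J"
      unfolding coordinate_cone_def using x
      by (intro sum_in_convex_cone_hull convex_cone_hull_mul hull_inc) auto
    finally show "x \<in> coordinate_cone J" .
  qed
qed

definition cancel_row :: "'n set \<Rightarrow> real ^ 'n \<Rightarrow> real ^ 'n::finite" where
  "cancel_row S a = (\<chi> j. if j \<in> S then 0 else a $ j)"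

text \<open>The value \<open>the_enat \<infinity>\<close> is unspecified, so
  \<open>cancel_index\<close> admits only sets \<open>S\<close> of coordinates with finite
  bounds.\<close>

definition cancel_rhs :: "('n::finite \<Rightarrow> enat) \<Rightarrow> 'n set \<Rightarrow> real ^ 'n \<Rightarrow> real \<Rightarrow> real" where
  "cancel_rhs u S a \<beta> = \<beta> - (\<Sum>j\<in>S. a $ j * real (the_enat (u j)))"

lemma inner_cancel_row:
  "cancel_row S a \<bullet> x = a \<bullet> x - (\<Sum>j\<in>S. a $ j * x $ j)"
proof -
  have "cancel_row S a \<bullet> x = (\<Sum>j\<in>UNIV. a $ j * x $ j - (if j \<in> S then a $ j * x $ j else 0))"
    by (auto simp: inner_vec_def cancel_row_def intro!: sum.cong)
  also have "\<dots> = a \<bullet> x - (\<Sum>j\<in>S. a $ j * x $ j)"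
    by (simp add: sum_subtractf inner_vec_def sum.If_cases)
  finally show ?thesis .
qed

text \<open>The row gets multiplier 1 and the bound on coordinate \<open>j \<in> S\<close> gets
  multiplier \<open>a $ j\<close>, which is exactly what cancels that coefficient.\<close>

lemma conic_combination_cancel:
  assumes "\<And>j. 0 \<le> a $ j" and S: "S \<subseteq> {j \<in> J. u j \<noteq> \<infinity>}"
  shows "conic_combination (insert (a, \<beta>) (bound_inequalities u J))
    (cancel_row S a, cancel_rhs u S a \<beta>)"
proof -
  let ?T = "insert (a, \<beta>) (bound_inequalities u J)"
  let ?s = "\<Sum>j\<in>S. a $ j *\<^sub>R (- axis j 1, - real (the_enat (u j)))"
  have "cancel_row S a = a + fst ?s"
    by (auto simp: vec_eq_iff cancel_row_def fst_sum axis_def if_distrib sum_negf cong: if_cong)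
  moreover have "cancel_rhs u S a \<beta> = \<beta> + snd ?s"
    by (simp add: cancel_rhs_def snd_sum sum_negf)
  ultimately have eq: "(cancel_row S a, cancel_rhs u S a \<beta>) = (a, \<beta>) + ?s"
    by (simp add: prod_eq_iff)
  have "?s \<in> convex_cone hull ?T"
    using assms
    by (intro sum_in_convex_cone_hull convex_cone_hull_mul hull_inc)
      (auto simp: bound_inequalities_def)
  then show ?thesis
    unfolding conic_combination_def eq by (rule convex_cone_hull_add[OF hull_inc[OF insertI1]])
qed

text \<open>A non-negative combination of inequalities valid at \<open>y\<close> is valid at
  \<open>y\<close>. The cancelled row is still non-negative, so passing to the larger point
  \<open>x\<close> preserves it.\<close>

lemma cancel_valid:
  assumes "\<And>j. 0 \<le> a $ j" and "\<And>j. j \<in> S \<Longrightarrow> y $ j \<le> real (the_enat (u j))"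
    and "\<And>j. y $ j \<le> x $ j" and "\<beta> \<le> a \<bullet> y"
  shows "cancel_rhs u S a \<beta> \<le> cancel_row S a \<bullet> x"
proof -
  have "(\<Sum>j\<in>S. a $ j * y $ j) \<le> (\<Sum>j\<in>S. a $ j * real (the_enat (u j)))"
    using assms by (intro sum_mono mult_left_mono) auto
  then have "cancel_rhs u S a \<beta> \<le> cancel_row S a \<bullet> y"
    using assms(4) by (simp add: cancel_rhs_def inner_cancel_row)
  also have "\<dots> \<le> cancel_row S a \<bullet> x"
    unfolding inner_vec_def using assms
    by (intro sum_mono) (auto simp: cancel_row_def intro!: mult_left_mono)
  finally show ?thesis .
qed

text \<open>The sign condition is there because \<open>covering_system\<close> demands non-negative
  right-hand sides.\<close>

definition cancel_index ::
    "nat \<Rightarrow> (nat \<Rightarrow> real ^ 'n) \<Rightarrow> (nat \<Rightarrow> real) \<Rightarrow> ('n::finite \<Rightarrow> enat) \<Rightarrow> 'n set \<Rightarrow> (nat \<times> 'n set) set"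
  where
  "cancel_index m A b u J =
     {(i, S). i < m \<and> S \<subseteq> {j \<in> J. u j \<noteq> \<infinity>} \<and> 0 \<le> cancel_rhs u S (A i) (b i)}"

lemma finite_cancel_index: "finite (cancel_index m A b u J)"
  by (rule finite_subset[of _ "{..<m} \<times> UNIV"]) (auto simp: cancel_index_def)

lemma polyhedron_plus_coordinate_cone:
  fixes u :: "'n::finite \<Rightarrow> enat"
  assumes A: "covering_system m A b"
  shows "bounded_polyhedron m A b u + coordinate_cone J =
    {x. (\<forall>j. 0 \<le> x $ j) \<and>
      (\<forall>(i, S) \<in> cancel_index m A b u J. cancel_row S (A i) \<bullet> x \<ge> cancel_rhs u S (A i) (b i)) \<and>
      (\<forall>j. ereal (x $ j) \<le> ereal_of_enat (if j \<in> J then \<infinity> else u j))}"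
    (is "?L = ?R")
proof
  show "?L \<subseteq> ?R"
  proof
    fix x assume "x \<in> ?L"
    then obtain y c where x: "x = y + c" and y: "y \<in> bounded_polyhedron m A b u"
      and c: "c \<in> coordinate_cone J"
      by (rule set_plus_elim)
    have yx: "y $ j \<le> x $ j" for j
      using c by (simp add: x coordinate_cone_eq)
    have "cancel_rhs u S (A i) (b i) \<le> cancel_row S (A i) \<bullet> x"
      if "(i, S) \<in> cancel_index m A b u J" for i S
    proof (rule cancel_valid[OF _ _ yx])
      show "0 \<le> A i $ j" for j
        using A that by (auto simp: covering_system_def cancel_index_def)
      show "y $ j \<le> real (the_enat (u j))" if "j \<in> S" for j
        using y that \<open>(i, S) \<in> _\<close>
        unfolding bounded_polyhedron_def cancel_index_def ereal_le_ereal_of_enat_iff by blast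
      show "b i \<le> A i \<bullet> y"
        using y that by (auto simp: bounded_polyhedron_def cancel_index_def)
    qed
    moreover have "0 \<le> x $ j" for j
      using y by (intro order_trans[OF _ yx]) (simp add: bounded_polyhedron_def)
    \<comment> \<open>Outside \<open>J\<close> the cone part \<open>c\<close> vanishes, so
      \<open>x\<close> inherits the bound from \<open>y\<close>.\<close>
    moreover have "ereal (x $ j) \<le> ereal_of_enat (if j \<in> J then \<infinity> else u j)" for j
      using y c by (auto simp: bounded_polyhedron_def coordinate_cone_eq x)
    ultimately show "x \<in> ?R" by auto
  qed
next
  show "?R \<subseteq> ?L"
  proof
    fix x assume "x \<in> ?R"
    then have x0: "0 \<le> x $ j"
      and xA: "(i, S) \<in> cancel_index m A b u J \<Longrightarrow>
            cancel_rhs u S (A i) (b i) \<le> cancel_row S (A i) \<bullet> x"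
      and xu: "j \<notin> J \<Longrightarrow> u j = \<infinity> \<or> x $ j \<le> real (the_enat (u j))" for i j S
      unfolding ereal_le_ereal_of_enat_iff by (blast, blast, simp split: if_splits) metis
    \<comment> \<open>\<open>S\<close> collects the coordinates in \<open>J\<close> at which
      \<open>x\<close> exceeds its bound. Hence \<open>x - y\<close> is non-negative and supported
      in \<open>J\<close>.\<close>
    define S where "S = {j \<in> J. u j \<noteq> \<infinity> \<and> real (the_enat (u j)) < x $ j}"
    define y where "y = (\<chi> j. if j \<in> S then real (the_enat (u j)) else x $ j)"
    have "b i \<le> A i \<bullet> y" if "i < m" for i
    proof -
      have "0 \<le> A i $ j" for j
        using A that by (simp add: covering_system_def)
      then have "0 \<le> cancel_row S (A i) \<bullet> x"
        using x0 by (auto simp: inner_vec_def cancel_row_def intro!: sum_nonneg)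
      \<comment> \<open>If the right-hand side is negative, this inequality is not among those
        indexed by \<open>cancel_index\<close>, but it follows from the non-negativity of the
        left-hand side.\<close>
      then have "cancel_rhs u S (A i) (b i) \<le> cancel_row S (A i) \<bullet> x"
        using xA[of i S] that by (cases "0 \<le> cancel_rhs u S (A i) (b i)")
          (auto simp: cancel_index_def S_def)
      \<comment> \<open>\<open>x\<close> and \<open>y\<close> differ only on \<open>S\<close>, where
        the cancelled row is zero.\<close>
      also have "\<dots> = cancel_row S (A i) \<bullet> y"
        unfolding inner_vec_def by (intro sum.cong) (auto simp: cancel_row_def y_def)
      \<comment> \<open>On \<open>S\<close> the point \<open>y\<close> meets its bounds with
        equality, so undoing the cancellation loses nothing and recovers \<open>b i\<close>.\<close>
      also have "\<dots> = A i \<bullet> y - (\<Sum>j\<in>S. A i $ j * real (the_enat (u j)))"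
        by (simp add: inner_cancel_row y_def)
      finally show ?thesis by (simp add: cancel_rhs_def)
    qed
    moreover have "0 \<le> y $ j" for j
      using x0 by (simp add: y_def)
    moreover have "u j = \<infinity> \<or> y $ j \<le> real (the_enat (u j))" for j
      using xu[of j] by (auto simp: y_def S_def)
    ultimately have "y \<in> bounded_polyhedron m A b u"
      by (simp add: bounded_polyhedron_def ereal_le_ereal_of_enat_iff)
    moreover have "x - y \<in> coordinate_cone J"
      by (auto simp: coordinate_cone_eq y_def S_def)
    ultimately have "y + (x - y) \<in> ?L" by (rule set_plus_intro)
    then show "x \<in> ?L" by simp
  qed
qed

text \<open>Systems are indexed by an initial segment of the naturals, so the finite set of pairs
  \<open>(i, S)\<close> is enumerated. The new bounds are kept explicit in order to see that they
  are all infinite when \<open>J\<close> is everything.\<close>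

lemma covering_description:
  fixes u :: "'n::finite \<Rightarrow> enat"
  assumes A: "covering_system m A b"
  obtains m' A' b' where "covering_system m' A' b'"
    and "bounded_polyhedron m A b u + coordinate_cone J =
      bounded_polyhedron m' A' b' (\<lambda>j. if j \<in> J then \<infinity> else u j)"
    and "\<And>k. k < m' \<Longrightarrow> \<exists>i<m.
      conic_combination (insert (A i, b i) (bound_inequalities u J)) (A' k, b' k)"
proof -
  obtain m' f where f: "cancel_index m A b u J = f ` {k::nat. k < m'}"
    using finite_imp_nat_seg_image_inj_on[OF finite_cancel_index] by metis
  define A' where "A' k = (case f k of (i, S) \<Rightarrow> cancel_row S (A i))" for k
  define b' where "b' k = (case f k of (i, S) \<Rightarrow> cancel_rhs u S (A i) (b i))" for k
  have row: "\<exists>i S. f k = (i, S) \<and> i < m \<and> S \<subseteq> {j \<in> J. u j \<noteq> \<infinity>} \<and> 0 \<le> b' k \<and>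
      A' k = cancel_row S (A i) \<and> b' k = cancel_rhs u S (A i) (b i)" if "k < m'" for k
  proof -
    have "f k \<in> cancel_index m A b u J" using f that by blast
    then show ?thesis by (auto simp: cancel_index_def A'_def b'_def)
  qed
  show thesis
  proof
    show "covering_system m' A' b'"
      unfolding covering_system_def
    proof (intro allI impI)
      fix k assume "k < m'"
      then obtain i S where k: "i < m" "0 \<le> b' k" "A' k = cancel_row S (A i)"
        "b' k = cancel_rhs u S (A i) (b i)"
        using row by blast
      have Ai: "\<And>j. A i $ j \<in> \<rat> \<and> 0 \<le> A i $ j" and bi: "b i \<in> \<rat>"
        using A k(1) by (auto simp: covering_system_def)
      \<comment> \<open>Finite bounds are integers, so subtracting rational multiples of them stays
        within the rationals.\<close>
      have "b' k \<in> \<rat>"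
        unfolding k cancel_rhs_def using Ai bi by (intro Rats_diff Rats_sum Rats_mult) auto
      then show "(\<forall>j. A' k $ j \<in> \<rat> \<and> 0 \<le> A' k $ j) \<and> b' k \<in> \<rat> \<and> 0 \<le> b' k"
        using Ai k(2) by (simp add: k(3) cancel_row_def)
    qed
    show "bounded_polyhedron m A b u + coordinate_cone J =
      bounded_polyhedron m' A' b' (\<lambda>j. if j \<in> J then \<infinity> else u j)"
      unfolding polyhedron_plus_coordinate_cone[OF A] f
      by (simp add: bounded_polyhedron_def A'_def b'_def split_beta)
    show "\<exists>i<m. conic_combination (insert (A i, b i) (bound_inequalities u J)) (A' k, b' k)"
      if "k < m'" for k
    proof -
      obtain i S where k: "i < m" "S \<subseteq> {j \<in> J. u j \<noteq> \<infinity>}" "A' k = cancel_row S (A i)"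
        "b' k = cancel_rhs u S (A i) (b i)"
        using row[OF \<open>k < m'\<close>] by blast
      have "\<And>j. 0 \<le> A i $ j"
        using A k(1) by (simp add: covering_system_def)
      then have "conic_combination (insert (A i, b i) (bound_inequalities u J)) (A' k, b' k)"
        unfolding k(3,4) by (rule conic_combination_cancel[OF _ k(2)])
      with k(1) show ?thesis by blast
    qed
  qed
qed

theorem proposition7:
  fixes m :: nat and A :: "nat \<Rightarrow> real ^ 'n" and b :: "nat \<Rightarrow> real"
    and u :: "'n \<Rightarrow> enat" and P :: "(real ^ 'n) set"
  assumes "covering_system m A b"
    and "P = bounded_polyhedron m A b u"
  shows "(\<forall>J. covering_polyhedron_with_bounds (P + coordinate_cone J)) \<and>
    covering_polyhedron (P + {x. \<forall>j. 0 \<le> x $ j}) \<and>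
    (\<forall>J. \<exists>m' A' b' u'.
        covering_system m' A' b' \<and>
        P + coordinate_cone J = bounded_polyhedron m' A' b' u' \<and>
        (\<forall>k<m'. \<exists>i<m.
            conic_combination (insert (A i, b i) (bound_inequalities u J)) (A' k, b' k)))"
proof (intro conjI allI)
  have description: "\<exists>m' A' b' u'. covering_system m' A' b' \<and>
      P + coordinate_cone J = bounded_polyhedron m' A' b' u' \<and>
      (\<forall>k<m'. \<exists>i<m.
          conic_combination (insert (A i, b i) (bound_inequalities u J)) (A' k, b' k))" for J
    by (rule covering_description[OF assms(1), of u J]) (use assms(2) in blast)
  then show "\<exists>m' A' b' u'. covering_system m' A' b' \<and>
      P + coordinate_cone J = bounded_polyhedron m' A' b' u' \<and>
      (\<forall>k<m'. \<exists>i<m.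
          conic_combination (insert (A i, b i) (bound_inequalities u J)) (A' k, b' k))" for J .
  show "covering_polyhedron_with_bounds (P + coordinate_cone J)" for J
    using description[of J] unfolding covering_polyhedron_with_bounds_def by blast
  \<comment> \<open>\<open>description\<close> hides the new bounds behind an existential
    quantifier, so the lemma itself is instantiated with \<open>J = UNIV\<close>, where the cone is
    the whole orthant.\<close>
  obtain m' A' b' where "covering_system m' A' b'"
    and "P + coordinate_cone UNIV = bounded_polyhedron m' A' b' (\<lambda>_. \<infinity>)"
    by (rule covering_description[OF assms(1), of u UNIV]) (simp add: assms(2))
  moreover have "coordinate_cone UNIV = {x :: real ^ 'n. \<forall>j. 0 \<le> x $ j}"
    by (simp add: coordinate_cone_eq)
  ultimately show "covering_polyhedron (P + {x. \<forall>j. 0 \<le> x $ j})"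
    unfolding covering_polyhedron_def by auto
qed

end
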